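(* Let $(Y,\rho)$ be any metric space, $f:\{\pm1\}^n\to Y$ any function, $T:\{\pm1\}^n\to Y$ any decision tree, and $\tau > 0$. Let $T^\star = \textsc{Prune}(f, T, \tau)$, where $\textsc{Prune}$ is the recursive procedure defined as follows: (1) if $T$ has depth $0$, return $T$; (2) otherwise let $x_i$ be the variable queried at the root of $T$ and $T_{-1}, T_1$ its left and right subtrees; (3) if $\mathrm{Inf}_i(f) > \tau$, return the tree with root querying $x_i$ whose left and right subtrees are $\textsc{Prune}(f_{x_i=-1}, T_{-1}, \tau)$ and $\textsc{Prune}(f_{x_i=1}, T_1, \tau)$; (4) if $\mathrm{Inf}_i(f) \le \tau$, return whichever of $\textsc{Prune}(f, T_{-1}, \tau)$ and $\textsc{Prune}(f, T_1, \tau)$ has smaller distance to $f$ (ties broken arbitrarily). Then: 1. The size and depth of $T^\star$ are at most the size and depth of $T$, respectively. 2. $T^\star$ is everywhere $\tau$-influential with respect to $f$. 3. $\mathrm{dist}(T^\star, f) \le \mathrm{dist}(T, f) + \Delta(T)\cdot \tau$.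
   Context: A decision tree $T:\{\pm1\}^n\to Y$ is a binary tree whose internal nodes query a variable $x_i$ and branch on its value, with leaves labeled by elements of $Y$; its size is its number of leaves, its depth the length of the longest root-to-leaf path, and its average depth is $\Delta(T) = \mathbb{E}_{\boldsymbol{x}}[\text{depth of the leaf reached by }\boldsymbol{x}] = \sum_{\text{leaves } \ell} 2^{-|\ell|}|\ell|$, with $\boldsymbol{x}$ uniform over $\{\pm1\}^n$ and $|\ell|$ the depth of $\ell$. For $g,h:\{\pm1\}^n\to Y$, $\mathrm{dist}(g,h) = \mathbb{E}_{\boldsymbol{x}}[\rho(g(\boldsymbol{x}),h(\boldsymbol{x}))]$. The influence of $i$ on $g$ is $\mathrm{Inf}_i(g) = \mathbb{E}_{\boldsymbol{x}}[\rho(g(\boldsymbol{x}), g(\boldsymbol{x}^{i}))]$ where $\boldsymbol{x}^i$ is $\boldsymbol{x}$ with its $i$-th coordinate rerandomized. $f_{x_i=b}$ denotes the function on $\{\pm1\}^n$ obtained by fixing $x_i = b$; more generally for a node $v$ of a tree, $f_v$ is $f$ restricted by fixing the variables along the root-to-$v$ path to their values on that path. A tree $T$ is everywhere $\tau$-influential with respect to $f$ if for every internal node $v$ of $T$, with $i(v)$ the variable queried at $v$, $\mathrm{Inf}_{i(v)}(f_v)\ge\tau$.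
   Formalization: Decision trees are taken to query no variable twice on a root-to-leaf path, as the formula for the average depth presupposes; without this, item 3 can fail because pruning may make a previously unreachable leaf reachable. *)

theory Defs
  imports "HOL-Probability.Probability" "HOL-Analysis.Abstract_Metric_Spaces"
begin

definition cube :: "nat \<Rightarrow> (nat \<Rightarrow> int) set" where
  "cube n = ({1..n} \<rightarrow>\<^sub>E {-1, 1})"

text \<open>
  Functions on the cube are HOL functions of type \<open>(nat \<Rightarrow> int) \<Rightarrow> 'y\<close>; only their values on
  \<open>cube n\<close> matter. The metric \<open>\<rho>\<close> is an explicit parameter throughout.
\<close>

definition fdist ::
  "nat \<Rightarrow> ('y \<Rightarrow> 'y \<Rightarrow> real) \<Rightarrow> ((nat \<Rightarrow> int) \<Rightarrow> 'y) \<Rightarrow> ((nat \<Rightarrow> int) \<Rightarrow> 'y) \<Rightarrow> real" where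
  "fdist n \<rho> g h = measure_pmf.expectation (pmf_of_set (cube n)) (\<lambda>x. \<rho> (g x) (h x))"

text \<open>The coordinate \<open>i\<close> is replaced by a fresh uniform sign \<open>b\<close>, independent of \<open>x\<close>.\<close>

definition influence ::
  "nat \<Rightarrow> ('y \<Rightarrow> 'y \<Rightarrow> real) \<Rightarrow> nat \<Rightarrow> ((nat \<Rightarrow> int) \<Rightarrow> 'y) \<Rightarrow> real" where
  "influence n \<rho> i g =
     measure_pmf.expectation (pair_pmf (pmf_of_set (cube n)) (pmf_of_set {-1, 1}))
       (\<lambda>(x, b). \<rho> (g x) (g (x(i := b))))"

definition restrict_var ::
  "((nat \<Rightarrow> int) \<Rightarrow> 'y) \<Rightarrow> nat \<Rightarrow> int \<Rightarrow> (nat \<Rightarrow> int) \<Rightarrow> 'y" where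
  "restrict_var f i b = (\<lambda>x. f (x(i := b)))"

text \<open>\<open>Query i l r\<close> continues with \<open>l\<close> if \<open>x i = -1\<close> and with \<open>r\<close> if \<open>x i = 1\<close>.\<close>

datatype 'y dtree = Leaf 'y | Query nat "'y dtree" "'y dtree"

text \<open>
  No variable is queried twice on a root-to-leaf path. This standard convention is what makes
  \<open>E[depth of the leaf reached]\<close> equal to the sum of \<open>2 ^ (-d) * d\<close> over the leaf depths \<open>d\<close>.
\<close>

fun dtree_over :: "nat set \<Rightarrow> 'y set \<Rightarrow> 'y dtree \<Rightarrow> bool" where
  "dtree_over V Y (Leaf y) \<longleftrightarrow> y \<in> Y"
| "dtree_over V Y (Query i l r) \<longleftrightarrow>
     i \<in> V \<and> dtree_over (V - {i}) Y l \<and> dtree_over (V - {i}) Y r"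

definition decision_tree :: "nat \<Rightarrow> 'y set \<Rightarrow> 'y dtree \<Rightarrow> bool" where
  "decision_tree n Y T \<longleftrightarrow> dtree_over {1..n} Y T"

fun dtree_eval :: "'y dtree \<Rightarrow> (nat \<Rightarrow> int) \<Rightarrow> 'y" where
  "dtree_eval (Leaf y) x = y"
| "dtree_eval (Query i l r) x = (if x i = -1 then dtree_eval l x else dtree_eval r x)"

fun num_leaves :: "'y dtree \<Rightarrow> nat" where
  "num_leaves (Leaf y) = 1"
| "num_leaves (Query i l r) = num_leaves l + num_leaves r"

fun depth :: "'y dtree \<Rightarrow> nat" where
  "depth (Leaf y) = 0"
| "depth (Query i l r) = Suc (max (depth l) (depth r))"

fun reached_depth :: "'y dtree \<Rightarrow> (nat \<Rightarrow> int) \<Rightarrow> nat" where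
  "reached_depth (Leaf y) x = 0"
| "reached_depth (Query i l r) x =
     Suc (if x i = -1 then reached_depth l x else reached_depth r x)"

definition avg_depth :: "nat \<Rightarrow> 'y dtree \<Rightarrow> real" where
  "avg_depth n T =
     measure_pmf.expectation (pmf_of_set (cube n)) (\<lambda>x. real (reached_depth T x))"

text \<open>
  A node is identified by its path from the root, the list of queried variables with the branch
  taken; \<open>node_at T p S\<close> says that \<open>p\<close> leads to a node of \<open>T\<close> whose subtree is \<open>S\<close>.
\<close>

inductive node_at :: "'y dtree \<Rightarrow> (nat \<times> int) list \<Rightarrow> 'y dtree \<Rightarrow> bool" where
  root: "node_at T [] T"
| left: "node_at l p S \<Longrightarrow> node_at (Query i l r) ((i, -1) # p) S"
| right: "node_at r p S \<Longrightarrow> node_at (Query i l r) ((i, 1) # p) S"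

fun restrict_path ::
  "((nat \<Rightarrow> int) \<Rightarrow> 'y) \<Rightarrow> (nat \<times> int) list \<Rightarrow> (nat \<Rightarrow> int) \<Rightarrow> 'y" where
  "restrict_path f [] = f"
| "restrict_path f ((i, b) # p) = restrict_path (restrict_var f i b) p"

definition everywhere_influential ::
  "nat \<Rightarrow> ('y \<Rightarrow> 'y \<Rightarrow> real) \<Rightarrow> real \<Rightarrow> ((nat \<Rightarrow> int) \<Rightarrow> 'y) \<Rightarrow> 'y dtree \<Rightarrow> bool" where
  "everywhere_influential n \<rho> \<tau> f T \<longleftrightarrow>
     (\<forall>p i l r. node_at T p (Query i l r) \<longrightarrow> influence n \<rho> i (restrict_path f p) \<ge> \<tau>)"

text \<open>
  \<open>prune n \<rho> \<tau> f T T'\<close>: \<open>T'\<close> is a possible output of the pruning procedure on \<open>(f, T, \<tau>)\<close>. It is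
  a relation because ties may be broken arbitrarily, independently at each recursive call.
\<close>

inductive prune ::
  "nat \<Rightarrow> ('y \<Rightarrow> 'y \<Rightarrow> real) \<Rightarrow> real \<Rightarrow> ((nat \<Rightarrow> int) \<Rightarrow> 'y) \<Rightarrow> 'y dtree \<Rightarrow> 'y dtree \<Rightarrow> bool"
  for n :: nat and \<rho> :: "'y \<Rightarrow> 'y \<Rightarrow> real" and \<tau> :: real
where
  leaf: "prune n \<rho> \<tau> f (Leaf y) (Leaf y)"
| keep: "influence n \<rho> i f > \<tau> \<Longrightarrow>
     prune n \<rho> \<tau> (restrict_var f i (-1)) l l' \<Longrightarrow>
     prune n \<rho> \<tau> (restrict_var f i 1) r r' \<Longrightarrow>
     prune n \<rho> \<tau> f (Query i l r) (Query i l' r')"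
| take_left: "influence n \<rho> i f \<le> \<tau> \<Longrightarrow>
     prune n \<rho> \<tau> f l l' \<Longrightarrow> prune n \<rho> \<tau> f r r' \<Longrightarrow>
     fdist n \<rho> (dtree_eval l') f \<le> fdist n \<rho> (dtree_eval r') f \<Longrightarrow>
     prune n \<rho> \<tau> f (Query i l r) l'"
| take_right: "influence n \<rho> i f \<le> \<tau> \<Longrightarrow>
     prune n \<rho> \<tau> f l l' \<Longrightarrow> prune n \<rho> \<tau> f r r' \<Longrightarrow>
     fdist n \<rho> (dtree_eval r') f \<le> fdist n \<rho> (dtree_eval l') f \<Longrightarrow>
     prune n \<rho> \<tau> f (Query i l r) r'"

lemma prune_total: "\<exists>T'. prune n \<rho> \<tau> f T T'"
proof (induction T arbitrary: f)
  case (Leaf y)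
  show ?case by (blast intro: prune.leaf)
next
  case (Query i l r)
  show ?case
  proof (cases "influence n \<rho> i f > \<tau>")
    case True
    then show ?thesis using Query.IH by (blast intro: prune.keep)
  next
    case False
    then have le: "influence n \<rho> i f \<le> \<tau>" by simp
    obtain l' r' where "prune n \<rho> \<tau> f l l'" "prune n \<rho> \<tau> f r r'"
      using Query.IH by blast
    then show ?thesis
      using le linear[of "fdist n \<rho> (dtree_eval l') f" "fdist n \<rho> (dtree_eval r') f"]
      by (blast intro: prune.take_left prune.take_right)
  qed
qed

end

theory Submission imports Defs begin

text \<open>
  Write \<open>f\<^sub>b\<close> for \<open>f\<close> restricted by \<open>x i = b\<close>. The distance bound is an induction on the run of
  the procedure. The only step that loses anything is the deletion of a query of \<open>i\<close> with
  \<open>Inf\<^sub>i(f) \<le> \<tau>\<close>: the better of the two subtrees is at most their average, and since the left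
  subtree \<open>l\<close> ignores \<open>i\<close>, the triangle inequality gives
  \<open>dist(l, f) = (dist(l, f\<^sub>-\<^sub>1) + dist(l, f\<^sub>1)) / 2 \<le> dist(l, f\<^sub>-\<^sub>1) + dist(f\<^sub>-\<^sub>1, f\<^sub>1) / 2\<close>, where the last
  summand is \<open>Inf\<^sub>i(f)\<close>; the right subtree is symmetric. So the deletion costs at most \<open>\<tau>\<close>, which is
  paid for by the contribution \<open>1\<close> of the deleted query to the average depth.
\<close>

lemma finite_cube: "finite (cube n)"
  unfolding cube_def by (intro finite_PiE) auto

lemma cube_nonempty: "cube n \<noteq> {}"
  unfolding cube_def by (simp add: PiE_eq_empty_iff)

lemma cube_upd: "x \<in> cube n \<Longrightarrow> i \<in> {1..n} \<Longrightarrow> b \<in> {-1, 1} \<Longrightarrow> x(i := b) \<in> cube n"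
  unfolding cube_def by (auto simp: PiE_iff extensional_def)

lemma cube_values: "x \<in> cube n \<Longrightarrow> i \<in> {1..n} \<Longrightarrow> x i = -1 \<or> x i = 1"
  unfolding cube_def by (auto simp: PiE_iff)

abbreviation cube_avg :: "nat \<Rightarrow> ((nat \<Rightarrow> int) \<Rightarrow> real) \<Rightarrow> real" where
  "cube_avg n \<equiv> measure_pmf.expectation (pmf_of_set (cube n))"

lemma cube_avg_eq_sum: "cube_avg n g = (\<Sum>x\<in>cube n. g x) / card (cube n)"
  by (rule integral_pmf_of_set[OF cube_nonempty finite_cube])

lemma cube_avg_add: "cube_avg n (\<lambda>x. g x + h x) = cube_avg n g + cube_avg n h"
  by (simp add: cube_avg_eq_sum sum.distrib add_divide_distrib)

lemma cube_avg_mono: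
  assumes "\<And>x. x \<in> cube n \<Longrightarrow> g x \<le> h x"
  shows "cube_avg n g \<le> cube_avg n h"
  using assms by (simp add: cube_avg_eq_sum divide_right_mono sum_mono)

lemma cube_avg_cong:
  assumes "\<And>x. x \<in> cube n \<Longrightarrow> g x = h x"
  shows "cube_avg n g = cube_avg n h"
  using assms by (simp add: cube_avg_eq_sum)

text \<open>Flipping coordinate \<open>i\<close> is an involution of the cube, so \<open>g\<close>
  and its flipped version have the same sum. Both averages on the right still run over the whole
  cube, not over a subcube, so restricted functions keep the same domain.\<close>

lemma cube_avg_split:
  assumes i: "i \<in> {1..n}"
  shows "cube_avg n g = (cube_avg n (\<lambda>x. g (x(i := -1))) + cube_avg n (\<lambda>x. g (x(i := 1)))) / 2"
proof -
  have flip: "x(i := - x i) \<in> cube n" if "x \<in> cube n" for x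
    using that cube_values[OF that i] by (auto intro: cube_upd[OF _ i])
  have "(\<Sum>x\<in>cube n. g x) = (\<Sum>x\<in>cube n. g (x(i := - x i)))"
    by (rule sum.reindex_bij_witness[where i = "\<lambda>x. x(i := - x i)" and j = "\<lambda>x. x(i := - x i)"])
      (auto simp: flip)
  then have "2 * (\<Sum>x\<in>cube n. g x) = (\<Sum>x\<in>cube n. g x + g (x(i := - x i)))"
    by (simp add: sum.distrib)
  \<comment> \<open>A point and its flip are \<open>x(i := -1)\<close> and \<open>x(i := 1)\<close>,
    in one order or the other.\<close>
  also have "\<dots> = (\<Sum>x\<in>cube n. g (x(i := -1)) + g (x(i := 1)))"
  proof (rule sum.cong)
    fix x assume "x \<in> cube n"
    then show "g x + g (x(i := - x i)) = g (x(i := -1)) + g (x(i := 1))"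
      using cube_values[OF _ i, of x] fun_upd_triv[of x i] by (auto simp del: fun_upd_triv)
  qed simp
  finally have "(\<Sum>x\<in>cube n. g x) =
      ((\<Sum>x\<in>cube n. g (x(i := -1))) + (\<Sum>x\<in>cube n. g (x(i := 1)))) / 2"
    by (simp add: sum.distrib)
  then show ?thesis
    by (simp add: cube_avg_eq_sum add_divide_distrib)
qed

lemma influence_eq_cube_avg:
  "influence n \<rho> i f =
     (cube_avg n (\<lambda>x. \<rho> (f x) (f (x(i := -1)))) + cube_avg n (\<lambda>x. \<rho> (f x) (f (x(i := 1))))) / 2"
proof -
  have "pair_pmf (pmf_of_set (cube n)) (pmf_of_set {-1, 1 :: int}) =
      pmf_of_set (cube n \<times> {-1, 1})"
    by (rule pmf_eqI)
      (auto simp: pmf_pair finite_cube cube_nonempty card_cartesian_product indicator_def)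
  then show ?thesis
    unfolding influence_def
    by (simp add: integral_pmf_of_set finite_cube cube_nonempty cube_avg_eq_sum
        card_cartesian_product sum.cartesian_product[symmetric] sum.distrib add_divide_distrib)
qed

text \<open>Splitting on the old value of coordinate \<open>i\<close> as well gives four equally
  likely pairs of old and new sign. Equal signs contribute 0, and the two unequal pairs contribute
  the same by symmetry of the metric; hence the factor 1/2.\<close>

lemma influence_eq_dist_restrictions:
  assumes M: "Metric_space Y \<rho>" and "f \<in> cube n \<rightarrow> Y" and i: "i \<in> {1..n}"
  shows "influence n \<rho> i f = fdist n \<rho> (restrict_var f i (-1)) (restrict_var f i 1) / 2"
proof -
  have in_Y: "f (x(i := b)) \<in> Y" if "x \<in> cube n" "b \<in> {-1, 1}" for x b
    using cube_upd[OF that(1) i that(2)] assms(2) by auto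
  have diag: "cube_avg n (\<lambda>x. \<rho> (f (x(i := b))) (f (x(i := b)))) = 0" if "b \<in> {-1, 1}" for b
    using in_Y that by (subst cube_avg_cong[where h = "\<lambda>_. 0"])
      (auto simp: Metric_space.mdist_zero[OF M])
  have swap: "\<rho> (f (x(i := 1))) (f (x(i := -1))) = \<rho> (f (x(i := -1))) (f (x(i := 1)))" for x
    by (rule Metric_space.commute[OF M])
  show ?thesis
    unfolding influence_eq_cube_avg fdist_def restrict_var_def
      cube_avg_split[OF i, of "\<lambda>x. \<rho> (f x) (f (x(i := -1)))"]
      cube_avg_split[OF i, of "\<lambda>x. \<rho> (f x) (f (x(i := 1)))"]
    by (simp add: diag swap)
qed

lemma dtree_over_mono: "dtree_over V Y T \<Longrightarrow> V \<subseteq> W \<Longrightarrow> dtree_over W Y T"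
proof (induction T arbitrary: V W)
  case (Query i l r)
  have "V - {i} \<subseteq> W - {i}" using Query.prems by auto
  then show ?case using Query by auto
qed simp

lemma dtree_eval_in: "dtree_over V Y T \<Longrightarrow> dtree_eval T x \<in> Y"
  by (induction T arbitrary: V) auto

text \<open>The convention that no variable is repeated on a path enters here: subtrees below a
  query of \<open>i\<close> are trees over \<open>V - {i}\<close>, hence blind to coordinate
  \<open>i\<close>.\<close>

lemma dtree_eval_upd: "dtree_over V Y T \<Longrightarrow> i \<notin> V \<Longrightarrow> dtree_eval T (x(i := b)) = dtree_eval T x"
  by (induction T arbitrary: V) fastforce+

lemma reached_depth_upd:
  "dtree_over V Y T \<Longrightarrow> i \<notin> V \<Longrightarrow> reached_depth T (x(i := b)) = reached_depth T x"
  by (induction T arbitrary: V) fastforce+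

lemma fdist_Query:
  assumes "i \<in> {1..n}" "dtree_over (V - {i}) Y l" "dtree_over (V - {i}) Y r"
  shows "fdist n \<rho> (dtree_eval (Query i l r)) f =
    (fdist n \<rho> (dtree_eval l) (restrict_var f i (-1)) +
     fdist n \<rho> (dtree_eval r) (restrict_var f i 1)) / 2"
  unfolding fdist_def restrict_var_def
  by (subst cube_avg_split[OF assms(1)])
    (simp add: dtree_eval_upd[OF assms(2)] dtree_eval_upd[OF assms(3)])

lemma avg_depth_Query:
  assumes "i \<in> {1..n}" "dtree_over (V - {i}) Y l" "dtree_over (V - {i}) Y r"
  shows "avg_depth n (Query i l r) = 1 + (avg_depth n l + avg_depth n r) / 2"
  unfolding avg_depth_def
  by (subst cube_avg_split[OF assms(1)])
    (simp add: reached_depth_upd[OF assms(2)] reached_depth_upd[OF assms(3)] cube_avg_add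
      add_divide_distrib)

lemma fdist_subtrees_le:
  assumes M: "Metric_space Y \<rho>" and f: "f \<in> cube n \<rightarrow> Y" and i: "i \<in> {1..n}"
    and l: "dtree_over (V - {i}) Y l" and r: "dtree_over (V - {i}) Y r"
  shows "(fdist n \<rho> (dtree_eval l) f + fdist n \<rho> (dtree_eval r) f) / 2 \<le>
    fdist n \<rho> (dtree_eval (Query i l r)) f + influence n \<rho> i f"
proof -
  let ?f0 = "restrict_var f i (-1)" and ?f1 = "restrict_var f i 1"
  have in_Y: "restrict_var f i b x \<in> Y" if "x \<in> cube n" "b \<in> {-1, 1}" for x b
    using cube_upd[OF that(1) i that(2)] f by (auto simp: restrict_var_def)
  have split: "fdist n \<rho> (dtree_eval t) f =
      (fdist n \<rho> (dtree_eval t) ?f0 + fdist n \<rho> (dtree_eval t) ?f1) / 2"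
    if "dtree_over (V - {i}) Y t" for t
    unfolding fdist_def restrict_var_def
    by (subst cube_avg_split[OF i]) (simp add: dtree_eval_upd[OF that])
  \<comment> \<open>\<open>l\<close> is already charged for its distance to \<open>?f0\<close> in
    the original tree. After the deletion it also answers where \<open>x i = 1\<close>, so its
    distance to \<open>?f1\<close> is bounded by a detour through \<open>?f0\<close>; for
    \<open>r\<close> the roles are exchanged.\<close>
  have "fdist n \<rho> (dtree_eval l) ?f1 \<le> fdist n \<rho> (dtree_eval l) ?f0 + fdist n \<rho> ?f0 ?f1"
    unfolding fdist_def cube_avg_add[symmetric]
    by (intro cube_avg_mono Metric_space.triangle[OF M] dtree_eval_in[OF l] in_Y) auto
  moreover have "fdist n \<rho> (dtree_eval r) ?f0 \<le> fdist n \<rho> (dtree_eval r) ?f1 + fdist n \<rho> ?f0 ?f1"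
    unfolding fdist_def cube_avg_add[symmetric] Metric_space.commute[OF M, of "?f0 x" "?f1 x" for x]
    by (intro cube_avg_mono Metric_space.triangle[OF M] dtree_eval_in[OF r] in_Y) auto
  ultimately show ?thesis
    unfolding fdist_Query[OF i l r] influence_eq_dist_restrictions[OF M f i] split[OF l] split[OF r]
    by (simp add: field_simps)
qed

lemma prune_size_depth:
  "prune n \<rho> \<tau> f T T' \<Longrightarrow> num_leaves T' \<le> num_leaves T \<and> depth T' \<le> depth T"
  by (induction rule: prune.induct) auto

text \<open>Below a kept query of \<open>i\<close> the pruned subtrees must also ignore
  \<open>i\<close>, so that \<open>fdist_Query\<close> applies to the output tree.\<close>

lemma prune_dtree_over: "prune n \<rho> \<tau> f T T' \<Longrightarrow> dtree_over V Y T \<Longrightarrow> dtree_over V Y T'"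
proof (induction arbitrary: V rule: prune.induct)
  case (take_left i f l l' r r')
  then show ?case using dtree_over_mono[of "V - {i}" Y l' V] by auto
next
  case (take_right i f l l' r r')
  then show ?case using dtree_over_mono[of "V - {i}" Y r' V] by auto
qed auto

lemma everywhere_influential_Query:
  assumes "influence n \<rho> i f \<ge> \<tau>"
    and "everywhere_influential n \<rho> \<tau> (restrict_var f i (-1)) l"
    and "everywhere_influential n \<rho> \<tau> (restrict_var f i 1) r"
  shows "everywhere_influential n \<rho> \<tau> f (Query i l r)"
  unfolding everywhere_influential_def
proof (intro allI impI)
  fix p j s t assume "node_at (Query i l r) p (Query j s t)"
  then show "influence n \<rho> j (restrict_path f p) \<ge> \<tau>"
    using assms unfolding everywhere_influential_def by cases fastforce+
qed

text \<open>After a deletion the surviving subtree was pruned against the unrestricted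
  \<open>f\<close>, so the induction hypothesis for it is already the claim. A kept query is
  influential by the test that kept it.\<close>

lemma prune_everywhere_influential:
  "prune n \<rho> \<tau> f T T' \<Longrightarrow> everywhere_influential n \<rho> \<tau> f T'"
proof (induction rule: prune.induct)
  case (leaf f y)
  show ?case
    unfolding everywhere_influential_def by (auto elim: node_at.cases)
qed (auto intro: everywhere_influential_Query)

text \<open>Bounding the average over both pruned subtrees serves both outcomes of the choice, since
  the closer subtree is at most the average.\<close>

lemma prune_deletion_cost:
  assumes M: "Metric_space Y \<rho>" and f: "f \<in> cube n \<rightarrow> Y" and V: "V \<subseteq> {1..n}"
    and T: "dtree_over V Y (Query i l r)" and inf: "influence n \<rho> i f \<le> \<tau>"
    and l: "fdist n \<rho> (dtree_eval l') f \<le> fdist n \<rho> (dtree_eval l) f + avg_depth n l * \<tau>"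
    and r: "fdist n \<rho> (dtree_eval r') f \<le> fdist n \<rho> (dtree_eval r) f + avg_depth n r * \<tau>"
  shows "(fdist n \<rho> (dtree_eval l') f + fdist n \<rho> (dtree_eval r') f) / 2 \<le>
    fdist n \<rho> (dtree_eval (Query i l r)) f + avg_depth n (Query i l r) * \<tau>"
proof -
  have i: "i \<in> {1..n}" and lr: "dtree_over (V - {i}) Y l" "dtree_over (V - {i}) Y r"
    using T V by auto
  have "avg_depth n (Query i l r) * \<tau> = \<tau> + (avg_depth n l * \<tau> + avg_depth n r * \<tau>) / 2"
    unfolding avg_depth_Query[OF i lr] by (simp add: field_simps)
  then show ?thesis
    using fdist_subtrees_le[OF M f i lr] inf l r by argo
qed

text \<open>The variable set \<open>V\<close> shrinks along the recursion while the cube keeps all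
  \<open>n\<close> coordinates, so the induction is over arbitrary \<open>V\<close> inside
  \<open>{1..n}\<close>.\<close>

lemma prune_fdist:
  assumes "prune n \<rho> \<tau> f T T'" "Metric_space Y \<rho>" "\<tau> \<ge> 0"
    and "f \<in> cube n \<rightarrow> Y" "dtree_over V Y T" "V \<subseteq> {1..n}"
  shows "fdist n \<rho> (dtree_eval T') f \<le> fdist n \<rho> (dtree_eval T) f + avg_depth n T * \<tau>"
  using assms(1,4-6)
proof (induction arbitrary: V rule: prune.induct)
  case (leaf f y)
  then show ?case by (simp add: avg_depth_def)
next
  case (keep i f l l' r r')
  have i: "i \<in> {1..n}" and lr: "dtree_over (V - {i}) Y l" "dtree_over (V - {i}) Y r"
    and V: "V - {i} \<subseteq> {1..n}"
    using keep.prems by auto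
  have lr': "dtree_over (V - {i}) Y l'" "dtree_over (V - {i}) Y r'"
    using keep.hyps lr by (auto intro: prune_dtree_over)
  have restr: "restrict_var f i b \<in> cube n \<rightarrow> Y" if "b \<in> {-1, 1}" for b
    using keep.prems(1) cube_upd[OF _ i that] by (auto simp: restrict_var_def)
  have "avg_depth n (Query i l r) * \<tau> = \<tau> + (avg_depth n l * \<tau> + avg_depth n r * \<tau>) / 2"
    unfolding avg_depth_Query[OF i lr] by (simp add: field_simps)
  moreover have "fdist n \<rho> (dtree_eval l') (restrict_var f i (-1)) \<le>
      fdist n \<rho> (dtree_eval l) (restrict_var f i (-1)) + avg_depth n l * \<tau>"
    by (rule keep.IH(1)[OF restr lr(1) V]) simp
  moreover have "fdist n \<rho> (dtree_eval r') (restrict_var f i 1) \<le>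
      fdist n \<rho> (dtree_eval r) (restrict_var f i 1) + avg_depth n r * \<tau>"
    by (rule keep.IH(2)[OF restr lr(2) V]) simp
  \<comment> \<open>A kept query loses nothing: the errors of the two halves just average. The extra
    \<open>\<tau>\<close> that it adds to the bound is slack, which is harmless because
    \<open>\<tau>\<close> is nonnegative.\<close>
  ultimately show ?case
    unfolding fdist_Query[OF i lr] fdist_Query[OF i lr'] using \<open>\<tau> \<ge> 0\<close> by argo
next
  case (take_left i f l l' r r')
  have lr: "dtree_over (V - {i}) Y l" "dtree_over (V - {i}) Y r" and V: "V - {i} \<subseteq> {1..n}"
    using take_left.prems by auto
  note f = take_left.prems(1)
  show ?case
    using prune_deletion_cost[OF assms(2) f take_left.prems(3,2) take_left.hyps(1)
        take_left.IH(1)[OF f lr(1) V] take_left.IH(2)[OF f lr(2) V]] take_left.hyps(4)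
    by argo
next
  case (take_right i f l l' r r')
  have lr: "dtree_over (V - {i}) Y l" "dtree_over (V - {i}) Y r" and V: "V - {i} \<subseteq> {1..n}"
    using take_right.prems by auto
  note f = take_right.prems(1)
  show ?case
    using prune_deletion_cost[OF assms(2) f take_right.prems(3,2) take_right.hyps(1)
        take_right.IH(1)[OF f lr(1) V] take_right.IH(2)[OF f lr(2) V]] take_right.hyps(4)
    by argo
qed

theorem theorem5:
  fixes n :: nat and Y :: "'y set" and \<rho> :: "'y \<Rightarrow> 'y \<Rightarrow> real"
    and f :: "(nat \<Rightarrow> int) \<Rightarrow> 'y" and T Tstar :: "'y dtree" and \<tau> :: real
  assumes "Metric_space Y \<rho>"
    and "f \<in> cube n \<rightarrow> Y"
    and "decision_tree n Y T"
    and "\<tau> > 0"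
    and "prune n \<rho> \<tau> f T Tstar"
  shows "(num_leaves Tstar \<le> num_leaves T \<and> depth Tstar \<le> depth T) \<and>
    everywhere_influential n \<rho> \<tau> f Tstar \<and>
    fdist n \<rho> (dtree_eval Tstar) f \<le> fdist n \<rho> (dtree_eval T) f + avg_depth n T * \<tau>"
proof -
  have "dtree_over {1..n} Y T" using assms(3) by (simp add: decision_tree_def)
  then show ?thesis
    using prune_size_depth[OF assms(5)] prune_everywhere_influential[OF assms(5)]
      prune_fdist[OF assms(5,1) _ assms(2)] assms(4) by simp
qed

end
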